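(* Let $M=\mathbf{R}^2$ with global coordinates $(x^0,x^1)$ and let $g=-a(x^0)(dx^0)^2+b(x^0)(dx^1)^2$, where $a,b\in C^1(\mathbf{R})$ are strictly positive functions. Fix an initial point $p=(x^0_0,x^1_0)\in\mathbf{R}^2$ and an initial velocity $v=(\tau_0,\xi_0)\in T_p\mathbf{R}^2$. If $\tau_0\neq0$, there exist $\delta>0$ and a unique geodesic $\gamma(s)=(x^0(s),x^1(s))\colon(-\delta,\delta)\to\mathbf{R}^2$ satisfying the initial conditions $\gamma(0)=p$ and $\dot\gamma(0)=v$. In particular, every non-trivial causal geodesic $\gamma$ satisfies $\tau_0\neq0$, where $\tau_0=\dot x^0(0)$ is the $x^0$-component of its initial velocity, hence local uniqueness (the existence of $\delta>0$ such that there is a unique geodesic on $(-\delta,\delta)$ with the given initial point and initial velocity) applies to all non-trivial causal geodesics.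
   Context: A geodesic is a $C^2$-curve $\gamma\colon I\to M$ solving $\ddot\gamma^k+\sum_{i,j}\Gamma^k_{ij}\dot\gamma^i\dot\gamma^j=0$, where $\Gamma^k_{ij}=\frac12\sum_l g^{kl}(\partial_ig_{jl}+\partial_jg_{il}-\partial_lg_{ij})$ are the Christoffel symbols of $g$ (continuous, since $g$ is $C^1$). A geodesic is causal if $g(\dot\gamma,\dot\gamma)\leq0$ along it; non-trivial means non-constant. *)

theory Defs
  imports "HOL-Analysis.Analysis"
begin

text \<open>A (pseudo-)metric on \<open>\<real>\<^sup>n\<close> in its global coordinates is given by the field of its
  coefficient matrices, \<open>g x $ i $ j\<close> being the \<open>(i, j)\<close> coefficient at \<open>x\<close>.\<close>

definition partial_deriv :: "'n::finite \<Rightarrow> (real^'n \<Rightarrow> real) \<Rightarrow> real^'n \<Rightarrow> real" where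
  "partial_deriv i f x = deriv (\<lambda>t. f (x + t *\<^sub>R axis i 1)) 0"

definition christoffel ::
    "(real^'n::finite \<Rightarrow> real^'n^'n) \<Rightarrow> 'n \<Rightarrow> 'n \<Rightarrow> 'n \<Rightarrow> real^'n \<Rightarrow> real" where
  "christoffel g k i j x = 1/2 * (\<Sum>l\<in>UNIV. matrix_inv (g x) $ k $ l *
      (partial_deriv i (\<lambda>y. g y $ j $ l) x
     + partial_deriv j (\<lambda>y. g y $ i $ l) x
     - partial_deriv l (\<lambda>y. g y $ i $ j) x))"

text \<open>Derivatives of a curve are taken within its interval of definition, so they are one-sided
  at an endpoint that belongs to the interval.\<close>

definition velocity :: "real set \<Rightarrow> (real \<Rightarrow> real^'n::finite) \<Rightarrow> real \<Rightarrow> real^'n" where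
  "velocity I \<gamma> s = vector_derivative \<gamma> (at s within I)"

definition acceleration :: "real set \<Rightarrow> (real \<Rightarrow> real^'n::finite) \<Rightarrow> real \<Rightarrow> real^'n" where
  "acceleration I \<gamma> = velocity I (velocity I \<gamma>)"

definition C2_curve_on :: "real set \<Rightarrow> (real \<Rightarrow> real^'n::finite) \<Rightarrow> bool" where
  "C2_curve_on I \<gamma> \<longleftrightarrow>
     \<gamma> differentiable_on I \<and> velocity I \<gamma> differentiable_on I \<and>
     continuous_on I (acceleration I \<gamma>)"

text \<open>A nonempty interior excludes only empty and one-point intervals, on which derivatives
  would be meaningless.\<close>

definition geodesic_on ::
    "(real^'n::finite \<Rightarrow> real^'n^'n) \<Rightarrow> real set \<Rightarrow> (real \<Rightarrow> real^'n) \<Rightarrow> bool" where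
  "geodesic_on g I \<gamma> \<longleftrightarrow>
     is_interval I \<and> interior I \<noteq> {} \<and> C2_curve_on I \<gamma> \<and>
     (\<forall>s\<in>I. \<forall>k. acceleration I \<gamma> s $ k +
        (\<Sum>i\<in>UNIV. \<Sum>j\<in>UNIV. christoffel g k i j (\<gamma> s) * velocity I \<gamma> s $ i * velocity I \<gamma> s $ j)
        = 0)"

definition causal_on ::
    "(real^'n::finite \<Rightarrow> real^'n^'n) \<Rightarrow> real set \<Rightarrow> (real \<Rightarrow> real^'n) \<Rightarrow> bool" where
  "causal_on g I \<gamma> \<longleftrightarrow>
     (\<forall>s\<in>I. (\<Sum>i\<in>UNIV. \<Sum>j\<in>UNIV. g (\<gamma> s) $ i $ j * velocity I \<gamma> s $ i * velocity I \<gamma> s $ j) \<le> 0)"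

definition geodesic_from ::
    "(real^'n::finite \<Rightarrow> real^'n^'n) \<Rightarrow> real set \<Rightarrow> real^'n \<Rightarrow> real^'n \<Rightarrow> (real \<Rightarrow> real^'n) \<Rightarrow> bool" where
  "geodesic_from g I p v \<gamma> \<longleftrightarrow> geodesic_on g I \<gamma> \<and> 0 \<in> I \<and> \<gamma> 0 = p \<and> velocity I \<gamma> 0 = v"

text \<open>Curves are total functions, so uniqueness is agreement on the interval.\<close>

definition locally_unique_geodesic ::
    "(real^'n::finite \<Rightarrow> real^'n^'n) \<Rightarrow> real^'n \<Rightarrow> real^'n \<Rightarrow> bool" where
  "locally_unique_geodesic g p v \<longleftrightarrow>
     (\<exists>\<delta>>0. \<exists>\<gamma>. geodesic_from g {-\<delta><..<\<delta>} p v \<gamma> \<and>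
        (\<forall>\<sigma>. geodesic_from g {-\<delta><..<\<delta>} p v \<sigma> \<longrightarrow> (\<forall>s\<in>{-\<delta><..<\<delta>}. \<sigma> s = \<gamma> s)))"

text \<open>The metric \<open>- a(x\<^sup>0) (dx\<^sup>0)\<^sup>2 + b(x\<^sup>0) (dx\<^sup>1)\<^sup>2\<close> on \<open>\<real>\<^sup>2\<close>. The index type \<open>2\<close> has exactly the
  elements \<open>0\<close> and \<open>1\<close> (with \<open>2 = 0\<close>), so \<open>x $ 0\<close> and \<open>x $ 1\<close> are the coordinates \<open>x\<^sup>0\<close>
  and \<open>x\<^sup>1\<close>.\<close>

definition warped_metric :: "(real \<Rightarrow> real) \<Rightarrow> (real \<Rightarrow> real) \<Rightarrow> real^2 \<Rightarrow> real^2^2" where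
  "warped_metric a b x =
     (\<chi> i j. if i = j then (if i = 0 then - a (x $ 0) else b (x $ 0)) else 0)"

end

theory Submission
  imports Defs
begin

text \<open>The Christoffel symbols are merely continuous, so uniqueness for the geodesic equation cannot come
  from a Lipschitz condition. Instead, \<open>b(x\<^sup>0) (x\<^sup>1)' = c\<close> and \<open>- a(x\<^sup>0) ((x\<^sup>0)')\<^sup>2 + b(x\<^sup>0) ((x\<^sup>1)')\<^sup>2 = E\<close>
  are conserved along geodesics, whence \<open>((x\<^sup>0)')\<^sup>2 = H(x\<^sup>0)\<close> with \<open>H = (c\<^sup>2 / b - E) / a\<close>. Where
  \<open>(x\<^sup>0)'\<close> does not vanish this is a separable first order equation, which has exactly one local
  solution, and \<open>x\<^sup>1\<close> is then recovered by integrating \<open>c / b(x\<^sup>0)\<close>. A causal geodesic with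
  \<open>(x\<^sup>0)'(0) = 0\<close> has \<open>c = E = 0\<close> and is therefore constant.\<close>

section \<open>Scalar autonomous equations\<close>

text \<open>\<open>G\<close> is the travel time from \<open>t0\<close>, an antiderivative of
  \<open>1 / P\<close>, and the solution is its inverse. Since \<open>P\<close> is at most
  \<open>K\<close>, the slope of \<open>G\<close> is at least \<open>1 / K\<close>; so
  \<open>G\<close> is onto and the flow is defined for all times.\<close>

lemma positive_field_flow:
  fixes P :: "real \<Rightarrow> real"
  assumes cont: "continuous_on UNIV P" and pos: "\<And>u. 0 < P u" and bound: "\<And>u. P u \<le> K"
  obtains G \<phi> where "\<And>u. (G has_real_derivative 1 / P u) (at u)"
    "\<And>u. \<phi> (G u) = u" "\<And>s. G (\<phi> s) = s" "\<phi> 0 = t0"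
    "\<And>s. (\<phi> has_real_derivative P (\<phi> s)) (at s)"
proof -
  have K: "0 < K" using pos[of 0] bound[of 0] by linarith
  have "isCont (\<lambda>u. 1 / P u) u" for u
    using cont pos[of u] by (auto intro!: continuous_intros simp: continuous_on_eq_continuous_at)
  then obtain F where F: "\<And>u. (F has_vector_derivative 1 / P u) (at u)"
    using einterval_antiderivative[of "-\<infinity>" \<infinity> "\<lambda>u. 1 / P u"] by auto
  define G where "G u = F u - F t0" for u
  have G: "(G has_real_derivative 1 / P u) (at u)" for u
    using F[of u] unfolding G_def has_real_derivative_iff_has_vector_derivative
    by (auto intro!: derivative_eq_intros)
  have Gc: "isCont G u" for u using G DERIV_isCont by blast
  have less: "G u < G w" if "u < w" for u w
    using that G pos by (intro DERIV_pos_imp_increasing[of u w G]) (auto intro!: exI)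
  have growth: "(w - u) / K \<le> G w - G u" if uw: "u < w" for u w
  proof -
    obtain z where "G w - G u = (w - u) * (1 / P z)"
      using MVT2[of u w G "\<lambda>u. 1 / P u", OF uw G] by blast
    moreover have "(w - u) * (1 / K) \<le> (w - u) * (1 / P z)"
      using uw pos[of z] bound[of z] by (intro mult_left_mono frac_le) auto
    ultimately show ?thesis by simp
  qed
  have surj: "\<exists>u. G u = s" for s
  proof -
    \<comment> \<open>The growth bound moves \<open>G\<close> by at least
      \<open>\<bar>s\<bar> + 1\<close> over a distance \<open>r\<close>, so the values at
      \<open>t0 - r\<close> and \<open>t0 + r\<close> enclose \<open>s\<close>.\<close>
    define r where "r = K * (\<bar>s\<bar> + 1)"
    have r: "0 < r" "r / K = \<bar>s\<bar> + 1" using K by (auto simp: r_def)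
    have "G t0 = 0" by (simp add: G_def)
    then have "G (t0 - r) \<le> s" "s \<le> G (t0 + r)"
      using growth[of t0 "t0 + r"] growth[of "t0 - r" t0] r by auto
    then show ?thesis
      using IVT[of G "t0 - r" s "t0 + r"] r Gc by auto
  qed
  have inj: "inj G" using less by (metis injI linorder_neqE_linordered_idom order_less_irrefl)
  define \<phi> where "\<phi> = inv G"
  have \<phi>G: "\<phi> (G u) = u" for u by (simp add: \<phi>_def inj)
  have G\<phi>: "G (\<phi> s) = s" for s unfolding \<phi>_def using surj by (metis f_inv_into_f rangeI)
  have "isCont \<phi> s" for s
    using isCont_inverse_function[of 1 "\<phi> s" \<phi> G] \<phi>G Gc G\<phi> by simp
  then have "(\<phi> has_real_derivative P (\<phi> s)) (at s)" for s
    using DERIV_inverse_function[of G "1 / P (\<phi> s)" \<phi> s "s - 1" "s + 1"] G[of "\<phi> s"] G\<phi> pos[of "\<phi> s"]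
    by auto
  moreover have "\<phi> 0 = t0" using \<phi>G[of t0] by (simp add: G_def)
  ultimately show thesis using that G \<phi>G G\<phi> by blast
qed

text \<open>While \<open>y\<close> moves with sign \<open>\<epsilon>\<close> inside
  \<open>U\<close>, the travel time \<open>G (y s)\<close> has derivative \<open>\<epsilon>\<close>,
  which forces \<open>y s = \<phi> (\<epsilon> * s)\<close>. A priori \<open>y\<close> could leave
  \<open>U\<close>, where \<open>eq\<close> says nothing; the model solution stays in
  \<open>U\<close>, and connectedness of \<open>S\<close> spreads the agreement from
  \<open>0\<close> to all of \<open>S\<close>.\<close>

lemma separable_unique:
  fixes y y' P G \<phi> :: "real \<Rightarrow> real"
  assumes S: "open S" "connected S" "0 \<in> S"
    and pos: "\<And>u. 0 < P u" and G: "\<And>u. (G has_real_derivative 1 / P u) (at u)"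
    and \<phi>G: "\<And>u. \<phi> (G u) = u" and G\<phi>: "\<And>s. G (\<phi> s) = s"
    and \<phi>_cont: "continuous_on UNIV \<phi>"
    and y: "\<And>s. s \<in> S \<Longrightarrow> (y has_real_derivative y' s) (at s)" and y'_cont: "continuous_on S y'"
    and U: "open U" "\<And>s. s \<in> S \<Longrightarrow> \<phi> (\<epsilon> * s) \<in> U"
    and eq: "\<And>s. s \<in> S \<Longrightarrow> y s \<in> U \<Longrightarrow> (y' s)\<^sup>2 = (P (y s))\<^sup>2"
    and \<epsilon>: "\<epsilon>\<^sup>2 = 1" and init: "y 0 = \<phi> 0" "0 < \<epsilon> * y' 0" and s: "s \<in> S"
  shows "y s = \<phi> (\<epsilon> * s)"
proof -
  \<comment> \<open>Only \<open>(y')\<^sup>2\<close> is prescribed; the sign condition, which excludes turning back, is closed,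
    and it is also open because \<open>y'\<close> has no zeros in \<open>T\<close>.\<close>
  define T where "T = {s \<in> S. y s = \<phi> (\<epsilon> * s) \<and> 0 \<le> \<epsilon> * y' s}"
  have yc: "continuous_on S y"
    using y by (meson DERIV_isCont continuous_at_imp_continuous_on)
  have "closedin (top_of_set S) {s \<in> S. y s = \<phi> (\<epsilon> * s)}"
    using yc by (intro continuous_closedin_preimage_constant[of S "\<lambda>s. y s - \<phi> (\<epsilon> * s)" 0, simplified]
      continuous_intros continuous_on_compose2[OF \<phi>_cont] subset_UNIV)
  moreover have "closedin (top_of_set S) (S \<inter> (\<lambda>s. \<epsilon> * y' s) -` {0..})"
    by (intro continuous_closedin_preimage continuous_intros y'_cont)
  ultimately have "closedin (top_of_set S) ({s \<in> S. y s = \<phi> (\<epsilon> * s)} \<inter> (S \<inter> (\<lambda>s. \<epsilon> * y' s) -` {0..}))"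
    by blast
  moreover have "{s \<in> S. y s = \<phi> (\<epsilon> * s)} \<inter> (S \<inter> (\<lambda>s. \<epsilon> * y' s) -` {0..}) = T"
    by (auto simp: T_def)
  ultimately have "closedin (top_of_set S) T" by simp
  moreover have "open T"
    unfolding open_contains_ball
  proof
    fix s assume "s \<in> T"
    then have s: "s \<in> S" "y s = \<phi> (\<epsilon> * s)" "0 \<le> \<epsilon> * y' s" by (auto simp: T_def)
    then have sU: "y s \<in> U" using U by simp
    have "y' s \<noteq> 0" using eq[OF s(1) sU] pos[of "y s"] by auto
    then have s_pos: "0 < \<epsilon> * y' s" using s(3) \<epsilon> by (auto simp: less_le)
    have "open (S \<inter> y -` U)" using continuous_open_preimage[OF yc S(1) U(1)] .
    moreover have "open (S \<inter> (\<lambda>s. \<epsilon> * y' s) -` {0<..})"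
      by (intro continuous_open_preimage continuous_intros y'_cont S(1))
    ultimately have "open ((S \<inter> y -` U) \<inter> (S \<inter> (\<lambda>s. \<epsilon> * y' s) -` {0<..}))" by blast
    then obtain e where e: "0 < e" and sub: "ball s e \<subseteq> (S \<inter> y -` U) \<inter> (S \<inter> (\<lambda>s. \<epsilon> * y' s) -` {0<..})"
      using s(1) sU s_pos unfolding open_contains_ball by blast
    have speed: "y' r / P (y r) = \<epsilon>" if "r \<in> ball s e" for r
    proof -
      have r: "r \<in> S" "y r \<in> U" "0 < \<epsilon> * y' r" using that sub by auto
      have "(\<epsilon> * y' r)\<^sup>2 = (P (y r))\<^sup>2" using eq[OF r(1,2)] \<epsilon> by (simp add: power_mult_distrib)
      then have "\<epsilon> * y' r = P (y r)" using r(3) pos[of "y r"] by (simp add: power2_eq_iff_nonneg)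
      then have "\<epsilon> * P (y r) = \<epsilon>\<^sup>2 * y' r" by (simp add: power2_eq_square)
      then show ?thesis using \<epsilon> pos[of "y r"] by (simp add: field_simps)
    qed
    \<comment> \<open>The difference is constant on the ball, and it vanishes at the centre because
      \<open>s\<close> lies in \<open>T\<close>.\<close>
    have "((\<lambda>r. G (y r) - \<epsilon> * r) has_real_derivative 0) (at r within ball s e)" if "r \<in> ball s e" for r
    proof -
      have "r \<in> S" using that sub by auto
      have "((\<lambda>r. G (y r) - \<epsilon> * r) has_real_derivative 1 / P (y r) * y' r - \<epsilon> * 1) (at r)"
        by (intro DERIV_diff DERIV_chain2[OF G y] \<open>r \<in> S\<close> DERIV_cmult DERIV_ident)
      then show ?thesis using speed[OF that] has_field_derivative_at_within by fastforce
    qed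
    from has_field_derivative_zero_constant[OF convex_ball this]
    obtain c where c: "\<And>r. r \<in> ball s e \<Longrightarrow> G (y r) - \<epsilon> * r = c" by blast
    have "c = 0" using c[of s] s(2) G\<phi>[of "\<epsilon> * s"] e by simp
    then have "y r = \<phi> (\<epsilon> * r)" if "r \<in> ball s e" for r
      using c[OF that] \<phi>G[of "y r"] by simp
    then have "ball s e \<subseteq> T" using sub by (auto simp: T_def less_imp_le)
    then show "\<exists>e>0. ball s e \<subseteq> T" using e by blast
  qed
  then have "openin (top_of_set S) T"
    by (intro open_subset) (auto simp: T_def)
  moreover have "0 \<in> T" using S(3) init by (auto simp: T_def)
  ultimately have "T = S" using S(2) by (auto simp: connected_clopen)
  then show ?thesis using s by (auto simp: T_def)
qed

section \<open>Curves\<close>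

lemma has_vector_derivative_vec_iff:
  fixes \<gamma> :: "real \<Rightarrow> real^'n::finite"
  shows "(\<gamma> has_vector_derivative D) (at s within I) \<longleftrightarrow>
    (\<forall>k. ((\<lambda>s. \<gamma> s $ k) has_real_derivative D $ k) (at s within I))"
  unfolding has_vector_derivative_def has_derivative_componentwise_within[of \<gamma>] has_field_derivative_def
  by (auto simp: Basis_vec_def inner_axis mult_commute_abs)

text \<open>An interval with nonempty interior is connected and not a single point, so each of its
  points is a limit point. Derivatives within it, one-sided ones included, are therefore
  unique.\<close>

lemma velocity_eqI:
  assumes "is_interval I" "interior I \<noteq> {}" "s \<in> I" "(\<gamma> has_vector_derivative D) (at s within I)"
  shows "velocity I \<gamma> s = D"
proof -
  have "s islimpt I"
    using assms(1-3) by (intro connected_imp_perfect)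
      (auto simp: is_interval_connected)
  then show ?thesis
    unfolding velocity_def using assms(4) by (intro vector_derivative_within) (auto simp: trivial_limit_within)
qed

text \<open>\<open>forall_2\<close>, \<open>sum_2\<close> and \<open>exhaust_2\<close> name the two
  indices \<open>1\<close> and \<open>2\<close>; this identity translates them to the coordinate
  indices \<open>0\<close> and \<open>1\<close>.\<close>

lemma two_eq_zero_2: "(2::2) = 0"
  by (metis exhaust_2 zero_neq_one)

lemma forall_2_zero_one: "(\<forall>i::2. Q i) \<longleftrightarrow> Q 0 \<and> Q 1"
  unfolding forall_2 two_eq_zero_2 by auto

lemma sum_2_zero_one: "sum f (UNIV :: 2 set) = f 0 + f 1"
  unfolding sum_2 two_eq_zero_2 by (simp add: add.commute)

lemma C2_curve_on_derivatives:
  assumes "C2_curve_on I \<gamma>" "s \<in> I"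
  shows "((\<lambda>s. \<gamma> s $ k) has_real_derivative velocity I \<gamma> s $ k) (at s within I)"
    "((\<lambda>s. velocity I \<gamma> s $ k) has_real_derivative acceleration I \<gamma> s $ k) (at s within I)"
proof -
  have "(\<gamma> has_vector_derivative velocity I \<gamma> s) (at s within I)"
    "(velocity I \<gamma> has_vector_derivative acceleration I \<gamma> s) (at s within I)"
    using assms unfolding C2_curve_on_def differentiable_on_def acceleration_def
    by (auto simp: velocity_def[of I \<gamma> s] velocity_def[of I "velocity I \<gamma>"] vector_derivative_works)
  then show "((\<lambda>s. \<gamma> s $ k) has_real_derivative velocity I \<gamma> s $ k) (at s within I)"
    "((\<lambda>s. velocity I \<gamma> s $ k) has_real_derivative acceleration I \<gamma> s $ k) (at s within I)"
    unfolding has_vector_derivative_vec_iff by blast+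
qed

section \<open>Geodesics of the warped metric\<close>

locale warped =
  fixes a b a' b' :: "real \<Rightarrow> real"
  assumes a: "\<And>t. (a has_real_derivative a' t) (at t)" and b: "\<And>t. (b has_real_derivative b' t) (at t)"
    and a'_cont: "continuous_on UNIV a'" and b'_cont: "continuous_on UNIV b'"
    and a_pos: "\<And>t. 0 < a t" and b_pos: "\<And>t. 0 < b t"
begin

section \<open>Inverse, partial derivatives and Christoffel symbols of the metric\<close>

text \<open>\<open>matrix_inv\<close> is a choice among two-sided inverses; their uniqueness
  identifies the choice with the diagonal matrix of reciprocals.\<close>

lemma matrix_inv_warped:
  "matrix_inv (warped_metric a b x) =
    (\<chi> i j. if i = j then (if i = 0 then - 1 / a (x $ 0) else 1 / b (x $ 0)) else 0)"
  (is "_ = ?B")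
proof -
  let ?A = "warped_metric a b x"
  have inv: "?A ** ?B = mat 1 \<and> ?B ** ?A = mat 1"
    using a_pos[of "x $ 0"] b_pos[of "x $ 0"]
    by (simp add: vec_eq_iff matrix_matrix_mult_def warped_metric_def mat_def forall_2_zero_one sum_2_zero_one)
  have "C = ?B" if "?A ** C = mat 1 \<and> C ** ?A = mat 1" for C
  proof -
    have "C = C ** (?A ** ?B)" using inv by simp
    also have "\<dots> = ?B" using that by (simp add: matrix_mul_assoc)
    finally show ?thesis .
  qed
  then show ?thesis unfolding matrix_inv_def using inv by (intro some_equality)
qed

lemma partial_deriv_warped:
  "partial_deriv i (\<lambda>y. warped_metric a b y $ j $ l) x =
    (if i = 0 \<and> j = l then (if j = 0 then - a' (x $ 0) else b' (x $ 0)) else 0)"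
proof -
  have shift: "((\<lambda>t. f (x $ 0 + t)) has_real_derivative D) (at 0)"
    if "(f has_real_derivative D) (at (x $ 0))" for f D
    using that DERIV_at_within_shift[of f D "x $ 0" 0 UNIV] by simp
  have "((\<lambda>t. - a (x $ 0 + t)) has_real_derivative - a' (x $ 0)) (at 0)"
    "((\<lambda>t. b (x $ 0 + t)) has_real_derivative b' (x $ 0)) (at 0)"
    by (intro DERIV_minus shift a b)+
  note d = this[THEN DERIV_imp_deriv]
  show ?thesis
    unfolding partial_deriv_def warped_metric_def using d
    by (cases "i = 0"; cases "j = l"; cases "j = 0"; simp add: axis_def)
qed

lemma christoffel_warped:
  "christoffel (warped_metric a b) k i j x =
    (if k = 0 then (if i \<noteq> j then 0 else (if i = 0 then a' (x $ 0) else b' (x $ 0)) / (2 * a (x $ 0)))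
     else (if i = j then 0 else b' (x $ 0) / (2 * b (x $ 0))))"
proof -
  have "i = 0 \<or> i = 1" "j = 0 \<or> j = 1" "k = 0 \<or> k = 1"
    using exhaust_2 unfolding two_eq_zero_2 by blast+
  then show ?thesis
    unfolding christoffel_def sum_2_zero_one matrix_inv_warped partial_deriv_warped
    by (elim disjE) simp_all
qed

text \<open>The sum has two equal mixed terms for \<open>k = 1\<close>, which cancel the factor
  \<open>1/2\<close> of the Christoffel symbol in the second equation.\<close>

lemma geodesic_equation_iff:
  "(\<forall>k. A $ k + (\<Sum>i\<in>UNIV. \<Sum>j\<in>UNIV. christoffel (warped_metric a b) k i j x * V $ i * V $ j) = 0) \<longleftrightarrow>
    A $ 0 = - (a' (x $ 0) * (V $ 0)\<^sup>2 + b' (x $ 0) * (V $ 1)\<^sup>2) / (2 * a (x $ 0)) \<and>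
    A $ 1 = - b' (x $ 0) / b (x $ 0) * V $ 0 * V $ 1"
proof -
  have "(A $ 0 + (a' (x $ 0) / (2 * a (x $ 0)) * V $ 0 * V $ 0 + b' (x $ 0) / (2 * a (x $ 0)) * V $ 1 * V $ 1) = 0)
    = (A $ 0 = - (a' (x $ 0) * (V $ 0)\<^sup>2 + b' (x $ 0) * (V $ 1)\<^sup>2) / (2 * a (x $ 0)))"
    by (simp add: add_divide_distrib diff_divide_distrib power2_eq_square mult.assoc; linarith)
  moreover have "b' (x $ 0) / (2 * b (x $ 0)) * V $ 0 * V $ 1 + b' (x $ 0) / (2 * b (x $ 0)) * V $ 1 * V $ 0
    = b' (x $ 0) / b (x $ 0) * V $ 0 * V $ 1"
    by simp
  ultimately show ?thesis
    by (simp add: forall_2_zero_one sum_2_zero_one christoffel_warped eq_neg_iff_add_eq_0 ac_simps)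
qed

section \<open>Geodesics as solutions of two scalar equations\<close>

lemma continuous_a: "continuous_on UNIV a" and continuous_b: "continuous_on UNIV b"
  using a b by (meson DERIV_isCont continuous_at_imp_continuous_on)+

lemma geodesic_onD:
  assumes "geodesic_on (warped_metric a b) I \<gamma>" "s \<in> I"
  shows "((\<lambda>s. \<gamma> s $ k) has_real_derivative velocity I \<gamma> s $ k) (at s within I)"
    and "((\<lambda>s. velocity I \<gamma> s $ 0) has_real_derivative
      - (a' (\<gamma> s $ 0) * (velocity I \<gamma> s $ 0)\<^sup>2 + b' (\<gamma> s $ 0) * (velocity I \<gamma> s $ 1)\<^sup>2) / (2 * a (\<gamma> s $ 0)))
      (at s within I)"
    and "((\<lambda>s. velocity I \<gamma> s $ 1) has_real_derivative
      - b' (\<gamma> s $ 0) / b (\<gamma> s $ 0) * velocity I \<gamma> s $ 0 * velocity I \<gamma> s $ 1) (at s within I)"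
proof -
  have C2: "C2_curve_on I \<gamma>" using assms by (simp add: geodesic_on_def)
  have "\<forall>k. acceleration I \<gamma> s $ k + (\<Sum>i\<in>UNIV. \<Sum>j\<in>UNIV.
      christoffel (warped_metric a b) k i j (\<gamma> s) * velocity I \<gamma> s $ i * velocity I \<gamma> s $ j) = 0"
    using assms by (simp add: geodesic_on_def)
  note acc = this[unfolded geodesic_equation_iff]
  show "((\<lambda>s. \<gamma> s $ k) has_real_derivative velocity I \<gamma> s $ k) (at s within I)"
    using C2_curve_on_derivatives[OF C2 assms(2)] by blast
  show "((\<lambda>s. velocity I \<gamma> s $ 0) has_real_derivative
      - (a' (\<gamma> s $ 0) * (velocity I \<gamma> s $ 0)\<^sup>2 + b' (\<gamma> s $ 0) * (velocity I \<gamma> s $ 1)\<^sup>2) / (2 * a (\<gamma> s $ 0)))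
      (at s within I)"
    using C2_curve_on_derivatives(2)[OF C2 assms(2), of 0] acc by simp
  show "((\<lambda>s. velocity I \<gamma> s $ 1) has_real_derivative
      - b' (\<gamma> s $ 0) / b (\<gamma> s $ 0) * velocity I \<gamma> s $ 0 * velocity I \<gamma> s $ 1) (at s within I)"
    using C2_curve_on_derivatives(2)[OF C2 assms(2), of 1] acc by simp
qed

text \<open>Verifies a curve constructed together with an explicit candidate \<open>w\<close> for
  its velocity. The acceleration is continuous because the equations express it through
  \<open>a\<close>, \<open>b\<close>, \<open>a'\<close>, \<open>b'\<close>, \<open>\<gamma>\<close>
  and \<open>w\<close>, all continuous.\<close>

lemma geodesic_onI:
  fixes \<gamma> w :: "real \<Rightarrow> real^2"
  assumes I: "is_interval I" "interior I \<noteq> {}"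
    and \<gamma>: "\<And>s k. s \<in> I \<Longrightarrow> ((\<lambda>s. \<gamma> s $ k) has_real_derivative w s $ k) (at s within I)"
    and w0: "\<And>s. s \<in> I \<Longrightarrow> ((\<lambda>s. w s $ 0) has_real_derivative
      - (a' (\<gamma> s $ 0) * (w s $ 0)\<^sup>2 + b' (\<gamma> s $ 0) * (w s $ 1)\<^sup>2) / (2 * a (\<gamma> s $ 0))) (at s within I)"
    and w1: "\<And>s. s \<in> I \<Longrightarrow> ((\<lambda>s. w s $ 1) has_real_derivative
      - b' (\<gamma> s $ 0) / b (\<gamma> s $ 0) * w s $ 0 * w s $ 1) (at s within I)"
  shows "geodesic_on (warped_metric a b) I \<gamma>" and "\<And>s. s \<in> I \<Longrightarrow> velocity I \<gamma> s = w s"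
proof -
  define A :: "real \<Rightarrow> real^2" where "A s = (\<chi> k. if k = 0
      then - (a' (\<gamma> s $ 0) * (w s $ 0)\<^sup>2 + b' (\<gamma> s $ 0) * (w s $ 1)\<^sup>2) / (2 * a (\<gamma> s $ 0))
      else - b' (\<gamma> s $ 0) / b (\<gamma> s $ 0) * w s $ 0 * w s $ 1)" for s
  have d1: "(\<gamma> has_vector_derivative w s) (at s within I)" if "s \<in> I" for s
    unfolding has_vector_derivative_vec_iff using \<gamma>[OF that] by blast
  then show vel: "velocity I \<gamma> s = w s" if "s \<in> I" for s
    using velocity_eqI[OF I that] that by blast
  have d2: "(w has_vector_derivative A s) (at s within I)" if "s \<in> I" for s
    unfolding has_vector_derivative_vec_iff forall_2_zero_one A_def using w0[OF that] w1[OF that] by simp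
  have d2': "(velocity I \<gamma> has_vector_derivative A s) (at s within I)" if "s \<in> I" for s
    using has_vector_derivative_transform[OF that, of "velocity I \<gamma>" w] vel d2[OF that] by blast
  then have acc: "acceleration I \<gamma> s = A s" if "s \<in> I" for s
    unfolding acceleration_def using velocity_eqI[OF I that] that by blast
  have \<gamma>c: "continuous_on I (\<lambda>s. \<gamma> s $ 0)" and wc: "continuous_on I (\<lambda>s. w s $ k)" for k
    by (intro continuous_on_component continuous_on_vector_derivative[of I _ w]
        continuous_on_vector_derivative[of I _ A] d1 d2; assumption)+
  have "continuous_on I A"
    unfolding A_def
  proof (rule continuous_on_vec_lambda)
    show "continuous_on I (\<lambda>s. if k = 0
        then - (a' (\<gamma> s $ 0) * (w s $ 0)\<^sup>2 + b' (\<gamma> s $ 0) * (w s $ 1)\<^sup>2) / (2 * a (\<gamma> s $ 0))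
        else - b' (\<gamma> s $ 0) / b (\<gamma> s $ 0) * w s $ 0 * w s $ 1)" for k :: 2
      by (cases "k = 0") (auto intro!: continuous_intros wc \<gamma>c continuous_on_compose2[OF a'_cont]
        continuous_on_compose2[OF b'_cont] continuous_on_compose2[OF continuous_a]
        continuous_on_compose2[OF continuous_b]
        simp: less_imp_neq[OF a_pos, symmetric] less_imp_neq[OF b_pos, symmetric])
  qed
  then have "continuous_on I (acceleration I \<gamma>)"
    using acc by (simp cong: continuous_on_cong)
  then have "C2_curve_on I \<gamma>"
    unfolding C2_curve_on_def differentiable_on_def using d1 d2' differentiableI_vector by blast
  moreover have "\<forall>k. acceleration I \<gamma> s $ k + (\<Sum>i\<in>UNIV. \<Sum>j\<in>UNIV.
      christoffel (warped_metric a b) k i j (\<gamma> s) * velocity I \<gamma> s $ i * velocity I \<gamma> s $ j) = 0"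
    if "s \<in> I" for s
    unfolding geodesic_equation_iff using acc[OF that] vel[OF that] by (simp add: A_def)
  ultimately show "geodesic_on (warped_metric a b) I \<gamma>"
    using I by (simp add: geodesic_on_def)
qed

section \<open>Conserved quantities and causal geodesics\<close>

text \<open>This is \<open>g(w, w)\<close> at any point with first coordinate
  \<open>t\<close>.\<close>

definition energy :: "real \<Rightarrow> real^2 \<Rightarrow> real" where
  "energy t w = - a t * (w $ 0)\<^sup>2 + b t * (w $ 1)\<^sup>2"

text \<open>The first quantity is the momentum belonging to the symmetry of the metric under
  translations in the second coordinate; the second is the squared length of the velocity. By the
  geodesic equations both have derivative zero on the convex set \<open>I\<close>.\<close>

lemma conserved:
  assumes geo: "geodesic_on (warped_metric a b) I \<gamma>" and "0 \<in> I" "s \<in> I"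
  shows "b (\<gamma> s $ 0) * velocity I \<gamma> s $ 1 = b (\<gamma> 0 $ 0) * velocity I \<gamma> 0 $ 1"
    and "energy (\<gamma> s $ 0) (velocity I \<gamma> s) = energy (\<gamma> 0 $ 0) (velocity I \<gamma> 0)"
proof -
  have cvx: "convex I" using geo by (simp add: geodesic_on_def is_interval_convex)
  note d = geodesic_onD[OF geo]
  have "((\<lambda>s. b (\<gamma> s $ 0) * velocity I \<gamma> s $ 1) has_real_derivative 0) (at s within I)" if "s \<in> I" for s
    using b_pos[of "\<gamma> s $ 0"]
    by (auto intro!: derivative_eq_intros d[OF that] DERIV_chain2[OF b])
  from has_field_derivative_zero_constant[OF cvx this]
  show "b (\<gamma> s $ 0) * velocity I \<gamma> s $ 1 = b (\<gamma> 0 $ 0) * velocity I \<gamma> 0 $ 1"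
    using assms by metis
  have "((\<lambda>s. energy (\<gamma> s $ 0) (velocity I \<gamma> s)) has_real_derivative 0) (at s within I)" if "s \<in> I" for s
    unfolding energy_def
    by (rule derivative_eq_intros refl d[OF that] DERIV_chain2[OF b] DERIV_chain2[OF a])+
      (use a_pos[of "\<gamma> s $ 0"] b_pos[of "\<gamma> s $ 0"] in \<open>simp add: field_simps power2_eq_square\<close>)
  from has_field_derivative_zero_constant[OF cvx this]
  show "energy (\<gamma> s $ 0) (velocity I \<gamma> s) = energy (\<gamma> 0 $ 0) (velocity I \<gamma> 0)"
    using assms by metis
qed

text \<open>If the first velocity component vanishes at \<open>0\<close>, causality there bounds
  \<open>b\<close> times the square of the second one by zero, so both conserved quantities are
  zero. Conserved momentum then kills the second component on all of \<open>I\<close>, and conserved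
  energy the first.\<close>

lemma causal_nonconstant:
  assumes geo: "geodesic_on (warped_metric a b) I \<gamma>" and I: "0 \<in> I"
    and causal: "causal_on (warped_metric a b) I \<gamma>" and nc: "\<not> \<gamma> constant_on I"
  shows "velocity I \<gamma> 0 $ 0 \<noteq> 0"
proof
  assume \<tau>0: "velocity I \<gamma> 0 $ 0 = 0"
  have "energy (\<gamma> 0 $ 0) (velocity I \<gamma> 0) \<le> 0"
    using causal I unfolding causal_on_def energy_def
    by (auto simp: sum_2_zero_one warped_metric_def power2_eq_square algebra_simps)
  then have \<xi>0: "velocity I \<gamma> 0 $ 1 = 0"
    using \<tau>0 b_pos[of "\<gamma> 0 $ 0"] by (simp add: energy_def mult_le_0_iff)
  have v0: "velocity I \<gamma> s $ k = 0" if "s \<in> I" for s k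
  proof -
    have "velocity I \<gamma> s $ 1 = 0"
      using conserved(1)[OF geo I that] \<xi>0 b_pos[of "\<gamma> s $ 0"] by simp
    moreover have "velocity I \<gamma> s $ 0 = 0"
      using conserved(2)[OF geo I that] \<tau>0 \<xi>0 calculation a_pos[of "\<gamma> s $ 0"] by (simp add: energy_def)
    ultimately have "\<forall>k. velocity I \<gamma> s $ k = 0" by (simp add: forall_2_zero_one)
    then show ?thesis ..
  qed
  have "convex I" using geo by (simp add: geodesic_on_def is_interval_convex)
  moreover have "(\<gamma> has_vector_derivative 0) (at s within I)" if "s \<in> I" for s
    unfolding has_vector_derivative_vec_iff using geodesic_onD(1)[OF geo that] v0[OF that] by simp
  ultimately obtain c where "\<And>s. s \<in> I \<Longrightarrow> \<gamma> s = c"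
    using has_vector_derivative_zero_constant by metis
  then show False using nc by (auto simp: constant_on_def)
qed

section \<open>Local existence and uniqueness\<close>

text \<open>The nonzero component makes \<open>H\<close> positive at \<open>t0\<close>, hence
  nearby, so \<open>sqrt (H u)\<close> is a nonvanishing speed there. Its flow yields a geodesic,
  and every competitor has the same constants \<open>c\<close> and \<open>E\<close>, hence obeys the
  same first order equations.\<close>

lemma locally_unique:
  fixes p v :: "real^2"
  assumes v0: "v $ 0 \<noteq> 0"
  shows "locally_unique_geodesic (warped_metric a b) p v"
proof -
  define t0 where "t0 = p $ 0"
  define c where "c = b t0 * v $ 1"
  define E where "E = energy t0 v"
  define H where "H u = (c\<^sup>2 / b u - E) / a u" for u
  \<comment> \<open>The derivative of \<open>H\<close>, obtained from
    \<open>a u * H u = c\<^sup>2 / b u - E\<close> by the product rule.\<close>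
  define H' where "H' u = (- (c\<^sup>2 * b' u / (b u)\<^sup>2) - a' u * H u) / a u" for u
  \<comment> \<open>Direction of motion in the first coordinate: the flow of the positive field
    \<open>P\<close> is run at time \<open>\<epsilon> * s\<close>, which also covers negative
    initial velocity.\<close>
  define \<epsilon> where "\<epsilon> = sgn (v $ 0)"
  have \<epsilon>: "\<epsilon>\<^sup>2 = 1" "0 < \<epsilon> * v $ 0" "\<epsilon> * \<bar>v $ 0\<bar> = v $ 0"
    using v0 by (auto simp: \<epsilon>_def sgn_if)
  have nz: "a u \<noteq> 0" "b u \<noteq> 0" for u using a_pos[of u] b_pos[of u] by simp_all
  have H: "(H has_real_derivative H' u) (at u)" for u
    unfolding H_def H'_def using nz[of u]
    by (auto intro!: derivative_eq_intros a b simp: power2_eq_square field_simps)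
  have speed: "(\<tau>\<^sup>2 = H u) = (- a u * \<tau>\<^sup>2 + b u * (c / b u)\<^sup>2 = E)" for \<tau> u
    using nz[of u] by (auto simp: H_def field_simps power2_eq_square)
  have Ht0: "H t0 = (v $ 0)\<^sup>2"
    using speed[of "v $ 0" t0] nz[of t0] by (simp add: E_def energy_def c_def)
  have Hc: "continuous_on UNIV H" using H by (meson DERIV_isCont continuous_at_imp_continuous_on)
  obtain r where r: "0 < r" and Hpos: "\<And>u. u \<in> {t0 - r..t0 + r} \<Longrightarrow> 0 < H u"
  proof -
    have "open (H -` {0<..})" using Hc by (simp add: open_vimage)
    then obtain r where "0 < r" "cball t0 r \<subseteq> H -` {0<..}"
      using Ht0 v0 unfolding open_contains_cball by (metis greaterThan_iff vimage_eq zero_less_power2)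
    then show thesis using that[of r] by (auto simp: cball_eq_atLeastAtMost subset_iff)
  qed
  define U where "U = {t0 - r<..<t0 + r}"
  \<comment> \<open>Clamping the argument of \<open>H\<close> makes the speed positive and bounded on all of \<open>\<real>\<close> without changing
    it on \<open>U\<close>, so that its flow is global.\<close>
  define clamped where "clamped u = max (t0 - r) (min (t0 + r) u)" for u
  define P where "P u = sqrt (H (clamped u))" for u
  have clamped: "clamped u \<in> {t0 - r..t0 + r}" for u using r by (auto simp: clamped_def)
  have PU: "P u = sqrt (H u)" if "u \<in> U" for u using that by (simp add: P_def clamped_def U_def)
  have "continuous_on UNIV P"
    unfolding P_def clamped_def by (intro continuous_intros continuous_on_compose2[OF Hc]) auto
  moreover have Ppos: "0 < P u" for u using Hpos[OF clamped] by (simp add: P_def)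
  moreover obtain K where "\<And>u. P u \<le> K"
  proof -
    have "compact (H ` {t0 - r..t0 + r})"
      using Hc by (intro compact_continuous_image) (auto intro: continuous_on_subset)
    then obtain K where "\<And>u. u \<in> {t0 - r..t0 + r} \<Longrightarrow> H u \<le> K"
      by (meson bounded_imp_bdd_above bdd_above.E compact_imp_bounded imageI)
    then show thesis using that[of "sqrt K"] clamped by (simp add: P_def)
  qed
  ultimately obtain G \<phi> where G: "\<And>u. (G has_real_derivative 1 / P u) (at u)"
    and \<phi>G: "\<And>u. \<phi> (G u) = u" and G\<phi>: "\<And>s. G (\<phi> s) = s" and \<phi>0: "\<phi> 0 = t0"
    and \<phi>: "\<And>s. (\<phi> has_real_derivative P (\<phi> s)) (at s)"
    using positive_field_flow[of P K t0] by metis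
  have \<phi>c: "continuous_on UNIV \<phi>" using \<phi> by (meson DERIV_isCont continuous_at_imp_continuous_on)
  define t where "t s = \<phi> (\<epsilon> * s)" for s
  have t0: "t 0 = t0" by (simp add: t_def \<phi>0)
  have dt: "(t has_real_derivative \<epsilon> * P (t s)) (at s)" for s
    unfolding t_def mult.commute[of \<epsilon> "P _"]
    using DERIV_chain2[OF \<phi> DERIV_cmult[OF DERIV_ident, where c = \<epsilon>]] by simp
  have tc: "continuous_on UNIV t" using dt by (meson DERIV_isCont continuous_at_imp_continuous_on)
  \<comment> \<open>The interval is chosen so that the model solution never leaves \<open>U\<close>,
    where \<open>P\<close> is the true speed \<open>sqrt (H u)\<close>.\<close>
  have "open (t -` U)" using tc by (simp add: open_vimage U_def)
  moreover have "0 \<in> t -` U" using r by (simp add: t0 U_def)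
  ultimately obtain \<delta> where \<delta>: "0 < \<delta>" and "ball 0 \<delta> \<subseteq> t -` U" unfolding open_contains_ball by blast
  define I where "I = {-\<delta><..<\<delta>}"
  have "I = ball 0 \<delta>" by (auto simp: I_def dist_real_def)
  then have tU: "t s \<in> U" if "s \<in> I" for s using that \<open>ball 0 \<delta> \<subseteq> t -` U\<close> by auto
  have I: "is_interval I" "interior I \<noteq> {}" "0 \<in> I" "open I" "connected I"
    using \<delta> by (auto simp: I_def is_interval_connected_1)
  have atI: "at s within I = at s" if "s \<in> I" for s using at_within_open[OF that I(4)] .
  have "isCont (\<lambda>s. c / b (t s)) s" for s
    using tc continuous_b nz by (auto intro!: continuous_intros isCont_o2[of _ t b] simp: continuous_on_eq_continuous_at)
  then obtain X where X: "\<And>s. (X has_real_derivative c / b (t s)) (at s)"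
    using einterval_antiderivative[of "-\<infinity>" \<infinity> "\<lambda>s. c / b (t s)"]
    by (auto simp: has_real_derivative_iff_has_vector_derivative)
  define \<gamma> :: "real \<Rightarrow> real^2" where "\<gamma> s = (\<chi> k. if k = 0 then t s else p $ 1 + X s - X 0)" for s
  define w :: "real \<Rightarrow> real^2" where "w s = (\<chi> k. if k = 0 then \<epsilon> * P (t s) else c / b (t s))" for s
  have \<gamma>_comp: "\<gamma> s $ 0 = t s" "\<gamma> s $ 1 = p $ 1 + X s - X 0" for s by (simp_all add: \<gamma>_def)
  have w_comp: "w s $ 0 = \<epsilon> * P (t s)" "w s $ 1 = c / b (t s)" for s by (simp_all add: w_def)
  have d\<gamma>: "((\<lambda>s. \<gamma> s $ k) has_real_derivative w s $ k) (at s within I)" for s k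
  proof -
    have "\<forall>k. ((\<lambda>s. \<gamma> s $ k) has_real_derivative w s $ k) (at s)"
      unfolding forall_2_zero_one \<gamma>_comp w_comp using dt X by (auto intro!: derivative_eq_intros)
    then show ?thesis using has_field_derivative_at_within by blast
  qed
  \<comment> \<open>Differentiating \<open>\<epsilon> * sqrt (H (t s))\<close> produces the factor
    \<open>t'\<close>, which equals \<open>\<epsilon> * sqrt (H (t s))\<close>. The roots cancel and
    \<open>\<epsilon>\<^sup>2 = 1\<close>, leaving half of \<open>H'\<close>.\<close>
  have dP: "((\<lambda>s. \<epsilon> * P (t s)) has_real_derivative H' (t s) / 2) (at s)" if "s \<in> I" for s
  proof -
    have pos: "0 < H (t s)" using Hpos[of "t s"] tU[OF that] by (auto simp: U_def)
    have "((\<lambda>s. \<epsilon> * sqrt (H (t s))) has_real_derivative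
        \<epsilon> * (inverse (sqrt (H (t s))) / 2 * (H' (t s) * (\<epsilon> * P (t s))))) (at s)"
      using pos by (intro DERIV_cmult DERIV_chain2[OF DERIV_real_sqrt] DERIV_chain2[OF H] dt) auto
    moreover have "\<epsilon> * (inverse (sqrt (H (t s))) / 2 * (H' (t s) * (\<epsilon> * P (t s)))) = H' (t s) / 2"
      using pos \<epsilon>(1) by (simp add: PU[OF tU[OF that]] power2_eq_square divide_simps)
    ultimately have "((\<lambda>s. \<epsilon> * sqrt (H (t s))) has_real_derivative H' (t s) / 2) (at s)"
      by metis
    then show ?thesis
      by (rule has_field_derivative_transform_within_open[OF _ I(4) that]) (simp add: PU tU)
  qed
  have speed_\<gamma>: "(\<epsilon> * P (t s))\<^sup>2 = H (t s)" if "s \<in> I" for s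
    using PU[OF tU[OF that]] Hpos[of "t s"] tU[OF that] \<epsilon> by (auto simp: power_mult_distrib U_def)
  have dw0: "((\<lambda>s. w s $ 0) has_real_derivative
      - (a' (\<gamma> s $ 0) * (w s $ 0)\<^sup>2 + b' (\<gamma> s $ 0) * (w s $ 1)\<^sup>2) / (2 * a (\<gamma> s $ 0))) (at s within I)"
    if "s \<in> I" for s
  proof -
    \<comment> \<open>This turns \<open>H' / 2\<close> into the right-hand side of the second order
      equation, with \<open>H\<close> as the squared first velocity component and
      \<open>c / b\<close> as the second component.\<close>
    have H'_eq: "H' (t s) / 2 = - (a' (t s) * H (t s) + b' (t s) * (c / b (t s))\<^sup>2) / (2 * a (t s))"
      using nz[of "t s"] by (simp add: H'_def field_simps power2_eq_square)
    show ?thesis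
      unfolding atI[OF that] \<gamma>_comp w_comp speed_\<gamma>[OF that] using dP[OF that, unfolded H'_eq] .
  qed
  have dw1: "((\<lambda>s. w s $ 1) has_real_derivative
      - b' (\<gamma> s $ 0) / b (\<gamma> s $ 0) * w s $ 0 * w s $ 1) (at s within I)" if "s \<in> I" for s
    unfolding atI[OF that] \<gamma>_comp w_comp using nz[of "t s"]
    by (auto intro!: derivative_eq_intros DERIV_chain2[OF b] dt)
  have "geodesic_on (warped_metric a b) I \<gamma>" and vel: "\<And>s. s \<in> I \<Longrightarrow> velocity I \<gamma> s = w s"
    using geodesic_onI[OF I(1,2) d\<gamma> dw0 dw1] by blast+
  moreover have "\<gamma> 0 = p" by (simp add: vec_eq_iff forall_2_zero_one \<gamma>_comp t0 t0_def)
  \<comment> \<open>Here \<open>P t0 = sqrt (H t0) = \<bar>v $ 0\<bar>\<close>, and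
    \<open>\<epsilon>\<close> restores the sign.\<close>
  moreover have "w 0 = v"
    using \<epsilon> nz[of t0] PU[OF tU[OF I(3)]]
    by (simp add: vec_eq_iff forall_2_zero_one w_comp t0 Ht0 c_def)
  ultimately have "geodesic_from (warped_metric a b) I p v \<gamma>"
    using I(3) by (simp add: geodesic_from_def)
  moreover have "\<sigma> s = \<gamma> s" if \<sigma>: "geodesic_from (warped_metric a b) I p v \<sigma>" and s: "s \<in> I" for \<sigma> s
  proof -
    have geo: "geodesic_on (warped_metric a b) I \<sigma>" and init: "\<sigma> 0 = p" "velocity I \<sigma> 0 = v"
      using \<sigma> by (auto simp: geodesic_from_def)
    have d: "((\<lambda>s. \<sigma> s $ k) has_real_derivative velocity I \<sigma> s $ k) (at s)" if "s \<in> I" for s k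
      using geodesic_onD(1)[OF geo that] atI[OF that] by simp
    have v1: "velocity I \<sigma> s $ 1 = c / b (\<sigma> s $ 0)" if "s \<in> I" for s
      using conserved(1)[OF geo I(3) that] nz by (simp add: init c_def t0_def field_simps)
    have v2: "(velocity I \<sigma> s $ 0)\<^sup>2 = H (\<sigma> s $ 0)" if "s \<in> I" for s
      using conserved(2)[OF geo I(3) that] v1[OF that] unfolding speed
      by (simp add: init E_def t0_def energy_def)
    have v_cont: "continuous_on I (\<lambda>s. velocity I \<sigma> s $ 0)"
      using geodesic_onD(2)[OF geo] by (meson DERIV_continuous continuous_on_eq_continuous_within)
    \<comment> \<open>Restricted to \<open>U\<close>, since outside it \<open>P\<close> is the
      clamped speed and may differ from \<open>sqrt (H u)\<close>.\<close>
    have speed_\<sigma>: "(velocity I \<sigma> s $ 0)\<^sup>2 = (P (\<sigma> s $ 0))\<^sup>2" if "s \<in> I" "\<sigma> s $ 0 \<in> U" for s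
      using v2[OF that(1)] PU[OF that(2)] Hpos[of "\<sigma> s $ 0"] that(2) by (auto simp: U_def)
    have \<sigma>0: "\<sigma> s $ 0 = t s" if "s \<in> I" for s
      unfolding t_def
      by (rule separable_unique[OF I(4,5,3) Ppos G \<phi>G G\<phi> \<phi>c d v_cont, where U = U and \<epsilon> = \<epsilon>])
        (use tU that \<epsilon> speed_\<sigma> in \<open>auto simp: U_def t_def init \<phi>0 t0_def\<close>)
    \<comment> \<open>With equal first coordinates, both second coordinates have derivative
      \<open>c / b (t s)\<close>.\<close>
    have "((\<lambda>s. \<sigma> s $ 1 - \<gamma> s $ 1) has_real_derivative 0) (at s within I)" if "s \<in> I" for s
      using DERIV_diff[OF d[OF that, of 1] d\<gamma>[of 1 s, unfolded atI[OF that]]] v1[OF that] \<sigma>0[OF that]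
      by (simp add: w_comp atI[OF that])
    from has_field_derivative_zero_constant[OF is_interval_convex[OF I(1)] this]
    obtain e where e: "\<And>s. s \<in> I \<Longrightarrow> \<sigma> s $ 1 - \<gamma> s $ 1 = e" by blast
    have "e = 0" using e[OF I(3)] init \<open>\<gamma> 0 = p\<close> by simp
    then show ?thesis using e[OF s] \<sigma>0[OF s] by (simp add: vec_eq_iff forall_2_zero_one \<gamma>_comp(1))
  qed
  ultimately show ?thesis
    unfolding locally_unique_geodesic_def I_def using \<delta> by blast
qed

end

theorem propositionA1:
  fixes a b :: "real \<Rightarrow> real"
  assumes "a C1_differentiable_on UNIV" and "b C1_differentiable_on UNIV"
    and "\<And>t. a t > 0" and "\<And>t. b t > 0"
  shows "(\<forall>p v :: real^2. v $ 0 \<noteq> 0 \<longrightarrow> locally_unique_geodesic (warped_metric a b) p v) \<and>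
    (\<forall>I \<gamma>. geodesic_on (warped_metric a b) I \<gamma> \<and> 0 \<in> I \<and>
        causal_on (warped_metric a b) I \<gamma> \<and> \<not> \<gamma> constant_on I \<longrightarrow>
      velocity I \<gamma> 0 $ 0 \<noteq> 0 \<and>
      locally_unique_geodesic (warped_metric a b) (\<gamma> 0) (velocity I \<gamma> 0))"
proof -
  obtain a' b' where "warped a b a' b'"
    using assms unfolding C1_differentiable_on_def warped_def
    by (auto simp: has_real_derivative_iff_has_vector_derivative)
  then interpret warped a b a' b' .
  show ?thesis using locally_unique causal_nonconstant by blast
qed

end
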